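(* There exists an absolute constant $C>0$ such that the following holds. Let $K\ge3$ and let $G$ be the graph with nodes $1,\dots,K$ only including the edges $k\to K$ for $k=1,\dots,K-1$. Then, for every $n\ge1$, $$\inf_{E_n}\sup_{\mu\in\mathcal{P}_G(\mathcal{X})}\int\mathcal{W}(E_n,\mu)\,d\mu^{\otimes n}\ge C\,n^{-1/d},$$ where the infimum ranges over all measurable maps $E_n:\mathcal{X}^n\to\mathcal{P}(\mathcal{X})$.
   Context: $\mathcal{X}=[0,1]^d=\mathcal{X}_1\times\dots\times\mathcal{X}_K$ with $\mathcal{X}_k=[0,1]^{d_k}$, $d_k\ge1$, $\sum_{k=1}^Kd_k=d$. For a directed acyclic graph $G$, $\mathcal{P}_G(\mathcal{X})$ is the set of Borel probability measures $\mu$ on $\mathcal{X}$ with $\mu(dx)=\prod_{k=1}^K\mu(dx_k\mid x_{\mathrm{pa}(k)})$, where $\mathrm{pa}(k)$ is the set of parents of $k$ and $\mu(dx_k\mid x_{\mathrm{pa}(k)})$ the regular conditional distribution (the $k$-th marginal if $\mathrm{pa}(k)=\emptyset$). $\mathcal{W}$ is the first-order Wasserstein distance on $\mathcal{P}(\mathcal{X})$ with respect to the sup-norm. *)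

theory Defs
  imports "HOL-Probability.Probability"
begin

text \<open>
  A vector \<open>d\<close> of block dimensions describes the blocks \<open>[0,1]\<^bsup>d k\<^esup>\<close>. A point of the product over
  an index set \<open>S\<close> is an extensional function \<open>x\<close> with coordinates \<open>x k i\<close> for \<open>k \<in> S\<close> and
  \<open>i \<in> {1..d k}\<close>; for \<open>S = {1..K}\<close> this is \<open>[0,1]\<^sup>d\<close> with total dimension \<open>\<Sum>k = 1..K. d k\<close>.
  As all products are finite, the product sigma-algebras are the Borel sigma-algebras.
\<close>

definition cube :: "nat \<Rightarrow> (nat \<Rightarrow> real) measure" where
  "cube m = (\<Pi>\<^sub>M i\<in>{1..m}. restrict_space borel {0..1})"

definition blocks :: "(nat \<Rightarrow> nat) \<Rightarrow> nat set \<Rightarrow> (nat \<Rightarrow> nat \<Rightarrow> real) measure" where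
  "blocks d S = (\<Pi>\<^sub>M k\<in>S. cube (d k))"

definition sup_dist ::
    "nat \<Rightarrow> (nat \<Rightarrow> nat) \<Rightarrow> (nat \<Rightarrow> nat \<Rightarrow> real) \<Rightarrow> (nat \<Rightarrow> nat \<Rightarrow> real) \<Rightarrow> real" where
  "sup_dist K d x y = Max ((\<lambda>(k, i). \<bar>x k i - y k i\<bar>) ` (SIGMA k:{1..K}. {1..d k}))"

definition couplings :: "'a measure \<Rightarrow> 'a measure \<Rightarrow> 'a measure \<Rightarrow> ('a \<times> 'a) measure set" where
  "couplings X \<mu> \<nu> =
     {\<pi> \<in> space (prob_algebra (X \<Otimes>\<^sub>M X)). distr \<pi> X fst = \<mu> \<and> distr \<pi> X snd = \<nu>}"

definition wasserstein ::
    "nat \<Rightarrow> (nat \<Rightarrow> nat) \<Rightarrow> (nat \<Rightarrow> nat \<Rightarrow> real) measure \<Rightarrow> (nat \<Rightarrow> nat \<Rightarrow> real) measure \<Rightarrow> ennreal" where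
  "wasserstein K d \<mu> \<nu> =
     (INF \<pi>\<in>couplings (blocks d {1..K}) \<mu> \<nu>. \<integral>\<^sup>+ (x, y). ennreal (sup_dist K d x y) \<partial>\<pi>)"

text \<open>A directed graph on \<open>{1..K}\<close> is given by its set of edges \<open>G\<close>, where \<open>(j, k) \<in> G\<close> means \<open>j \<rightarrow> k\<close>.\<close>

definition parents :: "(nat \<times> nat) set \<Rightarrow> nat \<Rightarrow> nat set" where
  "parents G k = {j. (j, k) \<in> G}"

text \<open>
  \<open>\<kappa>\<close> is a version of the regular conditional distribution of \<open>x k\<close> given \<open>(x j)\<close> for \<open>j \<in> A\<close>
  under \<open>\<mu>\<close>. For \<open>A = {}\<close> the conditioning space is a single point and \<open>\<kappa>\<close> is the \<open>k\<close>-th marginal.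
\<close>

definition is_reg_cond_distr ::
    "(nat \<Rightarrow> nat) \<Rightarrow> (nat \<Rightarrow> nat \<Rightarrow> real) measure \<Rightarrow> nat set \<Rightarrow> nat
      \<Rightarrow> ((nat \<Rightarrow> nat \<Rightarrow> real) \<Rightarrow> (nat \<Rightarrow> real) measure) \<Rightarrow> bool" where
  "is_reg_cond_distr d \<mu> A k \<kappa> \<longleftrightarrow>
     \<kappa> \<in> blocks d A \<rightarrow>\<^sub>M prob_algebra (cube (d k)) \<and>
     (\<forall>P\<in>sets (blocks d A). \<forall>Q\<in>sets (cube (d k)).
        emeasure \<mu> {x \<in> space \<mu>. restrict x A \<in> P \<and> x k \<in> Q} =
        (\<integral>\<^sup>+ z\<in>P. emeasure (\<kappa> z) Q \<partial>distr \<mu> (blocks d A) (\<lambda>x. restrict x A)))"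

text \<open>
  Topological orderings are listed in reverse: every node is preceded by its descendants and
  followed by its parents. Such an ordering of all nodes exists iff the graph is acyclic.
\<close>

primrec topo_order :: "(nat \<times> nat) set \<Rightarrow> nat list \<Rightarrow> bool" where
  "topo_order G [] \<longleftrightarrow> True"
| "topo_order G (k # ks) \<longleftrightarrow> k \<notin> set ks \<and> parents G k \<subseteq> set ks \<and> topo_order G ks"

text \<open>
  The product \<open>\<Prod>\<^sub>k \<kappa>\<^sub>k(dx\<^sub>k | x\<^bsub>pa(k)\<^esub>)\<close>: along a (reversed) topological ordering, draw \<open>x k\<close> from
  \<open>\<kappa> k\<close> evaluated at the already drawn coordinates of the parents of \<open>k\<close>. The resulting measure
  does not depend on the choice of the topological ordering.
\<close>

primrec kernel_product ::
    "(nat \<Rightarrow> nat) \<Rightarrow> (nat \<times> nat) set \<Rightarrow> (nat \<Rightarrow> (nat \<Rightarrow> nat \<Rightarrow> real) \<Rightarrow> (nat \<Rightarrow> real) measure)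
      \<Rightarrow> nat list \<Rightarrow> (nat \<Rightarrow> nat \<Rightarrow> real) measure" where
  "kernel_product d G \<kappa> [] = return (blocks d {}) (\<lambda>_. undefined)"
| "kernel_product d G \<kappa> (k # ks) =
     kernel_product d G \<kappa> ks \<bind>
       (\<lambda>x. distr (\<kappa> k (restrict x (parents G k))) (blocks d (insert k (set ks))) (\<lambda>y. x(k := y)))"

text \<open>
  Regular conditional distributions are unique only up to null sets, but whether \<open>\<mu>\<close> equals their
  product does not depend on the chosen versions.
\<close>

definition graph_measures ::
    "nat \<Rightarrow> (nat \<Rightarrow> nat) \<Rightarrow> (nat \<times> nat) set \<Rightarrow> (nat \<Rightarrow> nat \<Rightarrow> real) measure set" where
  "graph_measures K d G =
     {\<mu> \<in> space (prob_algebra (blocks d {1..K})).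
        \<exists>ks \<kappa>. topo_order G ks \<and> set ks = {1..K} \<and>
          (\<forall>k\<in>{1..K}. is_reg_cond_distr d \<mu> (parents G k) k (\<kappa> k)) \<and>
          \<mu> = kernel_product d G \<kappa> ks}"

definition collider_graph :: "nat \<Rightarrow> (nat \<times> nat) set" where
  "collider_graph K = {(k, K) | k. k \<in> {1..K - 1}}"

text \<open>
  \<open>prob_algebra\<close> carries the sigma-algebra generated by the evaluations \<open>\<mu> \<mapsto> \<mu> A\<close>, which on a Polish
  space is the Borel sigma-algebra of weak convergence.
\<close>

definition estimators ::
    "nat \<Rightarrow> (nat \<Rightarrow> nat) \<Rightarrow> nat \<Rightarrow> ((nat \<Rightarrow> nat \<Rightarrow> nat \<Rightarrow> real) \<Rightarrow> (nat \<Rightarrow> nat \<Rightarrow> real) measure) set" where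
  "estimators K d n =
     (\<Pi>\<^sub>M i\<in>{1..n}. blocks d {1..K}) \<rightarrow>\<^sub>M prob_algebra (blocks d {1..K})"

end

theory Submission
  imports Defs
begin

text \<open>
  Let \<open>D\<close> be the total dimension. On the grid \<open>{0, 1/m, \<dots>, (m - 1)/m}\<^sup>D\<close> with \<open>m\<^sup>D \<ge> 2 n\<close>, every set \<open>s\<close> of
  grid points gives a measure: move the points of \<open>s\<close> by \<open>1/(2 m)\<close> in the first coordinate of the last
  block and take the uniform distribution on the result. The first \<open>K - 1\<close> blocks remain independent,
  so all these measures lie in the collider model. At least half of the grid points are not hit by a
  sample of size \<open>n\<close>. Flipping the membership of these points in \<open>s\<close> leaves the sample, and thus
  the estimate, unchanged, but moves the measure by at least \<open>1/(4 m)\<close> in Wasserstein distance; the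
  estimate is therefore off by \<open>1/(8 m)\<close> on average over the two choices. Averaging over all \<open>s\<close> and choosing
  \<open>m\<close> of order \<open>n\<^bsup>1/D\<^esup>\<close> gives the bound.
\<close>

subsection \<open>Uniform distributions on finite families\<close>

text \<open>Points are indexed by \<open>S\<close> and counted with multiplicity: a value taken at
  several indices gets the sum of their weights. Images, finite products and compositions with
  kernels keep this form, which turns identities of measures into counting.\<close>

definition unif :: "'b measure \<Rightarrow> 'a set \<Rightarrow> ('a \<Rightarrow> 'b) \<Rightarrow> 'b measure" where
  "unif X S f = distr (uniform_count_measure S) X f"

lemma measurable_uniform_count_measure:
  assumes "f \<in> S \<rightarrow> space X"
  shows "f \<in> uniform_count_measure S \<rightarrow>\<^sub>M X"
  using assms by (auto simp: measurable_def space_uniform_count_measure sets_uniform_count_measure)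

lemma sets_unif[simp, measurable_cong]: "sets (unif X S f) = sets X"
  by (simp add: unif_def)

lemma space_unif[simp]: "space (unif X S f) = space X"
  by (simp add: unif_def)

lemma nn_integral_unif:
  assumes "finite S" "f \<in> S \<rightarrow> space X" "h \<in> borel_measurable X"
  shows "(\<integral>\<^sup>+ x. h x \<partial>unif X S f) = ennreal (1 / card S) * (\<Sum>s\<in>S. h (f s))"
  unfolding unif_def
  using assms
  by (simp add: nn_integral_distr measurable_uniform_count_measure)
     (simp add: uniform_count_measure_def nn_integral_point_measure_finite sum_distrib_left)

lemma integral_unif:
  fixes h :: "'b \<Rightarrow> real"
  assumes "finite S" "f \<in> S \<rightarrow> space X" "h \<in> borel_measurable X"
  shows "(\<integral>x. h x \<partial>unif X S f) = (\<Sum>s\<in>S. h (f s)) / card S"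
  unfolding unif_def
  using assms
  by (simp add: integral_distr measurable_uniform_count_measure integral_uniform_count_measure)

lemma emeasure_unif:
  assumes "finite S" "f \<in> S \<rightarrow> space X" "A \<in> sets X"
  shows "emeasure (unif X S f) A = ennreal (card {s \<in> S. f s \<in> A} / card S)"
proof -
  have "f -` A \<inter> S = {s \<in> S. f s \<in> A}" by auto
  then show ?thesis
    unfolding unif_def using assms
    by (simp add: emeasure_distr measurable_uniform_count_measure space_uniform_count_measure
        emeasure_uniform_count_measure)
qed

lemma prob_space_unif:
  assumes "finite S" "S \<noteq> {}" "f \<in> S \<rightarrow> space X"
  shows "prob_space (unif X S f)"
  unfolding unif_def
  by (intro prob_space.prob_space_distr prob_space_uniform_count_measure
      measurable_uniform_count_measure assms)

lemma unif_in_prob_algebra: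
  assumes "finite S" "S \<noteq> {}" "f \<in> S \<rightarrow> space X"
  shows "unif X S f \<in> space (prob_algebra X)"
  by (simp add: space_prob_algebra prob_space_unif assms)

lemma unif_cong:
  assumes "\<And>s. s \<in> S \<Longrightarrow> f s = g s"
  shows "unif X S f = unif X S g"
  unfolding unif_def
  by (intro distr_cong) (auto simp: space_uniform_count_measure assms)

lemma distr_unif:
  assumes "f \<in> S \<rightarrow> space X" "g \<in> X \<rightarrow>\<^sub>M Y"
  shows "distr (unif X S f) Y g = unif Y S (\<lambda>s. g (f s))"
  unfolding unif_def using assms
  by (simp add: distr_distr measurable_uniform_count_measure comp_def)

lemma unif_reindex:
  assumes "finite S" "bij_betw h T S" "f \<in> S \<rightarrow> space X"
  shows "unif X S f = unif X T (\<lambda>t. f (h t))"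
proof (rule measure_eqI)
  fix A assume "A \<in> sets (unif X S f)"
  then have A: "A \<in> sets X" by simp
  have T: "finite T" using assms bij_betw_finite by blast
  have "bij_betw h {t \<in> T. f (h t) \<in> A} {s \<in> S. f s \<in> A}"
    using assms(2) by (auto simp: bij_betw_def inj_on_def)
  then have "card {t \<in> T. f (h t) \<in> A} = card {s \<in> S. f s \<in> A}"
    by (rule bij_betw_same_card)
  moreover have "card T = card S" using assms(2) by (rule bij_betw_same_card)
  moreover have "(\<lambda>t. f (h t)) \<in> T \<rightarrow> space X"
    using assms(2,3) by (auto simp: bij_betw_def)
  ultimately show "emeasure (unif X S f) A = emeasure (unif X T (\<lambda>t. f (h t))) A"
    using assms T A by (simp add: emeasure_unif)
qed simp

text \<open>All kernels share the index set \<open>T\<close>, so every pair in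
  \<open>S \<times> T\<close> gets the same weight. The claim then follows by counting, for each
  \<open>s\<close>, the indices \<open>t\<close> whose point lands in the given set.\<close>

lemma bind_unif:
  assumes S: "finite S" "S \<noteq> {}" "f \<in> S \<rightarrow> space X"
    and T: "finite T" "\<And>s. s \<in> S \<Longrightarrow> g s \<in> T \<rightarrow> space Y"
    and N: "N \<in> X \<rightarrow>\<^sub>M subprob_algebra Y" "\<And>s. s \<in> S \<Longrightarrow> N (f s) = unif Y T (g s)"
  shows "unif X S f \<bind> N = unif Y (S \<times> T) (\<lambda>(s, t). g s t)"
proof (rule measure_eqI)
  have ne: "space (unif X S f) \<noteq> {}" using S by auto
  have N': "N \<in> unif X S f \<rightarrow>\<^sub>M subprob_algebra Y"
    using N(1) by (simp cong: measurable_cong_sets)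
  show sets: "sets (unif X S f \<bind> N) = sets (unif Y (S \<times> T) (\<lambda>(s, t). g s t))"
    using sets_bind[OF sets_kernel[OF N'] ne] by simp
  fix A assume "A \<in> sets (unif X S f \<bind> N)"
  then have A: "A \<in> sets Y" by (simp add: sets)
  have "emeasure (unif X S f \<bind> N) A = (\<integral>\<^sup>+ x. emeasure (N x) A \<partial>unif X S f)"
    by (rule emeasure_bind[OF ne N' A])
  also have "\<dots> = ennreal (1 / card S) * (\<Sum>s\<in>S. emeasure (N (f s)) A)"
    by (rule nn_integral_unif) (use S N A in \<open>auto intro: measurable_emeasure_kernel\<close>)
  also have "(\<Sum>s\<in>S. emeasure (N (f s)) A) = (\<Sum>s\<in>S. ennreal (card {t \<in> T. g s t \<in> A} / card T))"
    by (intro sum.cong) (auto simp: N(2) emeasure_unif T A)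
  also have "\<dots> = ennreal (real (\<Sum>s\<in>S. card {t \<in> T. g s t \<in> A}) / card T)"
    by (simp add: sum_ennreal sum_divide_distrib)
  also have "(\<Sum>s\<in>S. card {t \<in> T. g s t \<in> A}) = card (SIGMA s:S. {t \<in> T. g s t \<in> A})"
    using S T by (subst card_SigmaI) auto
  also have "(SIGMA s:S. {t \<in> T. g s t \<in> A}) = {p \<in> S \<times> T. (case p of (s, t) \<Rightarrow> g s t) \<in> A}"
    by auto
  also have "ennreal (1 / card S) * ennreal (real (card \<dots>) / card T)
      = emeasure (unif Y (S \<times> T) (\<lambda>(s, t). g s t)) A"
    using S T A by (subst emeasure_unif) (auto simp: card_cartesian_product simp flip: ennreal_mult)
  finally show "emeasure (unif X S f \<bind> N) A = emeasure (unif Y (S \<times> T) (\<lambda>(s, t). g s t)) A" .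
qed

text \<open>No measurability of \<open>h\<close> is assumed, as \<open>\<omega> \<mapsto> wasserstein K d (E \<omega>) \<mu>\<close> is not known to be measurable.\<close>

lemma nn_integral_unif_ge:
  assumes S: "finite S" "f \<in> S \<rightarrow> space X"
    and sing: "\<And>s. s \<in> S \<Longrightarrow> {f s} \<in> sets X"
  shows "ennreal (1 / card S) * (\<Sum>s\<in>S. h (f s)) \<le> (\<integral>\<^sup>+ x. h x \<partial>unif X S f)"
proof -
  \<comment> \<open>\<open>h'\<close> agrees with \<open>h\<close> on the finitely many atoms and
    vanishes elsewhere. It is measurable because the atoms are measurable points, and it lies below
    \<open>h\<close>.\<close>
  define h' where "h' x = (\<Sum>y\<in>f ` S. h y * indicator {y} x)" for x
  have m: "h' \<in> borel_measurable X"
    unfolding h'_def using sing by (intro borel_measurable_sum) auto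
  have eq: "h' x = (if x \<in> f ` S then h x else 0)" for x
    unfolding h'_def using S(1) by (simp add: indicator_def if_distrib sum.delta cong: if_cong)
  have "ennreal (1 / card S) * (\<Sum>s\<in>S. h (f s)) = ennreal (1 / card S) * (\<Sum>s\<in>S. h' (f s))"
    by (simp add: eq)
  also have "\<dots> = (\<integral>\<^sup>+ x. h' x \<partial>unif X S f)"
    by (rule nn_integral_unif[symmetric]) (use S m in auto)
  also have "\<dots> \<le> (\<integral>\<^sup>+ x. h x \<partial>unif X S f)"
    by (intro nn_integral_mono) (simp add: eq)
  finally show ?thesis .
qed

text \<open>Independent draws amount to one uniform choice of an index tuple, since counts factorize
  over boxes. The law of the tuple involves \<open>S\<close> but not \<open>f\<close>, so samples
  from different measures can later be compared for the same tuple.\<close>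

lemma PiM_unif:
  assumes I: "finite I" and S: "finite S" "S \<noteq> {}" "f \<in> S \<rightarrow> space X"
  shows "(\<Pi>\<^sub>M i\<in>I. unif X S f) = unif (\<Pi>\<^sub>M i\<in>I. X) (I \<rightarrow>\<^sub>E S) (\<lambda>\<omega>. \<lambda>i\<in>I. f (\<omega> i))"
proof -
  interpret prob_space "unif X S f" by (rule prob_space_unif[OF S])
  interpret product_sigma_finite "\<lambda>_. unif X S f" ..
  have sp: "(\<lambda>\<omega>. \<lambda>i\<in>I. f (\<omega> i)) \<in> (I \<rightarrow>\<^sub>E S) \<rightarrow> space (\<Pi>\<^sub>M i\<in>I. X)"
    using S by (auto simp: space_PiM)
  have "unif (\<Pi>\<^sub>M i\<in>I. X) (I \<rightarrow>\<^sub>E S) (\<lambda>\<omega>. \<lambda>i\<in>I. f (\<omega> i)) = (\<Pi>\<^sub>M i\<in>I. unif X S f)"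
  proof (rule PiM_eqI[OF I])
    show "sets (unif (\<Pi>\<^sub>M i\<in>I. X) (I \<rightarrow>\<^sub>E S) (\<lambda>\<omega>. \<lambda>i\<in>I. f (\<omega> i))) = sets (\<Pi>\<^sub>M i\<in>I. unif X S f)"
      by (simp cong: sets_PiM_cong)
    fix A assume A: "\<And>i. i \<in> I \<Longrightarrow> A i \<in> sets (unif X S f)"
    have eq: "{\<omega> \<in> I \<rightarrow>\<^sub>E S. (\<lambda>i\<in>I. f (\<omega> i)) \<in> Pi\<^sub>E I A} = (\<Pi>\<^sub>E i\<in>I. {s \<in> S. f s \<in> A i})"
    proof (intro equalityI subsetI)
      fix \<omega> assume "\<omega> \<in> (\<Pi>\<^sub>E i\<in>I. {s \<in> S. f s \<in> A i})"
      then show "\<omega> \<in> {\<omega> \<in> I \<rightarrow>\<^sub>E S. (\<lambda>i\<in>I. f (\<omega> i)) \<in> Pi\<^sub>E I A}" by (simp add: PiE_iff)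
    qed (simp add: PiE_iff)
    have "emeasure (unif (\<Pi>\<^sub>M i\<in>I. X) (I \<rightarrow>\<^sub>E S) (\<lambda>\<omega>. \<lambda>i\<in>I. f (\<omega> i))) (Pi\<^sub>E I A)
        = ennreal (card (\<Pi>\<^sub>E i\<in>I. {s \<in> S. f s \<in> A i}) / card (I \<rightarrow>\<^sub>E S))"
      unfolding eq[symmetric]
      using I S A by (intro emeasure_unif sp finite_PiE sets_PiM_I_finite) auto
    also have "\<dots> = ennreal (\<Prod>i\<in>I. card {s \<in> S. f s \<in> A i} / card S)"
      using I by (simp add: card_PiE prod_dividef)
    also have "\<dots> = (\<Prod>i\<in>I. emeasure (unif X S f) (A i))"
      using A S by (subst prod_ennreal[symmetric]) (auto simp: emeasure_unif)
    finally show "emeasure (unif (\<Pi>\<^sub>M i\<in>I. X) (I \<rightarrow>\<^sub>E S) (\<lambda>\<omega>. \<lambda>i\<in>I. f (\<omega> i))) (Pi\<^sub>E I A)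
        = (\<Prod>i\<in>I. emeasure (unif X S f) (A i))" .
  qed
  then show ?thesis by simp
qed

text \<open>Only finitely many measurable points are singled out, so the values of \<open>p\<close>
  on them can be arbitrary. This gives measurability of the conditional law of the last block, which
  varies irregularly with the grid point of the parents.\<close>

lemma measurable_finite_cases:
  assumes "finite S" "\<And>a. a \<in> S \<Longrightarrow> {a} \<in> sets X" "\<And>a. a \<in> S \<Longrightarrow> p a \<in> space Y" "q \<in> space Y"
  shows "(\<lambda>z. if z \<in> S then p z else q) \<in> X \<rightarrow>\<^sub>M Y"
  using assms
proof (induction S rule: finite_induct)
  case (insert a S)
  have "(\<lambda>z. if z \<in> {a} then p a else (if z \<in> S then p z else q)) \<in> X \<rightarrow>\<^sub>M Y"
    using insert.prems insert.IH by (intro measurable_If_set[OF measurable_const]) auto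
  then show ?case
    by (rule measurable_cong[THEN iffD1, rotated]) auto
qed simp

section \<open>Points of cubes and blocks as measurable sets\<close>

lemma singleton_sets_PiM:
  assumes "finite I" "x \<in> extensional I" "\<And>i. i \<in> I \<Longrightarrow> {x i} \<in> sets (M i)"
  shows "{x} \<in> sets (PiM I M)"
proof -
  have "(\<Pi>\<^sub>E i\<in>I. {x i}) \<in> sets (PiM I M)"
    using assms by (intro sets_PiM_I_finite) auto
  also have "(\<Pi>\<^sub>E i\<in>I. {x i}) = {x}"
    using PiE_singleton[OF assms(2)] .
  finally show ?thesis .
qed

lemma space_cube: "space (cube m) = {1..m} \<rightarrow>\<^sub>E {0..1}"
  by (simp add: cube_def space_PiM space_restrict_space)

lemma space_blocks: "space (blocks d S) = (\<Pi>\<^sub>E k\<in>S. space (cube (d k)))"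
  by (simp add: blocks_def space_PiM)

lemma singleton_sets_cube:
  assumes "x \<in> space (cube m)"
  shows "{x} \<in> sets (cube m)"
proof -
  have "{y} \<in> sets (restrict_space borel {0..1})" if "y \<in> {0..1::real}" for y
    using that by (subst sets_restrict_space_iff) auto
  then show ?thesis
    using assms unfolding cube_def
    by (intro singleton_sets_PiM) (auto simp: space_PiM PiE_iff space_restrict_space)
qed

lemma singleton_sets_blocks:
  assumes "finite S" "x \<in> space (blocks d S)"
  shows "{x} \<in> sets (blocks d S)"
  using assms unfolding blocks_def
  by (intro singleton_sets_PiM) (auto simp: space_PiM PiE_iff intro: singleton_sets_cube)

subsection \<open>Wasserstein distance\<close>

text \<open>The easy half of Kantorovich duality.\<close>

lemma wasserstein_ge_Lipschitz:
  fixes g :: "(nat \<Rightarrow> nat \<Rightarrow> real) \<Rightarrow> real"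
  assumes g[measurable]: "g \<in> borel_measurable (blocks d {1..K})"
    and bdd: "\<And>x. \<bar>g x\<bar> \<le> B"
    and lip: "\<And>x y. \<bar>g x - g y\<bar> \<le> sup_dist K d x y"
  shows "ennreal \<bar>(\<integral>x. g x \<partial>\<mu>) - (\<integral>x. g x \<partial>\<nu>)\<bar> \<le> wasserstein K d \<mu> \<nu>"
  unfolding wasserstein_def
proof (rule INF_greatest)
  let ?X = "blocks d {1..K}"
  fix \<pi> assume \<pi>: "\<pi> \<in> couplings ?X \<mu> \<nu>"
  then have sets[measurable_cong]: "sets \<pi> = sets (?X \<Otimes>\<^sub>M ?X)" and "prob_space \<pi>"
    and marg: "\<mu> = distr \<pi> ?X fst" "\<nu> = distr \<pi> ?X snd"
    by (auto simp: couplings_def space_prob_algebra)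
  then interpret prob_space \<pi> by simp
  have int: "integrable \<pi> (\<lambda>p. g (fst p))" "integrable \<pi> (\<lambda>p. g (snd p))"
    using bdd by (auto intro!: integrable_const_bound[where B = B])
  have "(\<integral>x. g x \<partial>\<mu>) - (\<integral>x. g x \<partial>\<nu>) = (\<integral>p. g (fst p) - g (snd p) \<partial>\<pi>)"
    unfolding marg using int by (simp add: integral_distr[OF _ g] del: One_nat_def)
  then have "ennreal \<bar>(\<integral>x. g x \<partial>\<mu>) - (\<integral>x. g x \<partial>\<nu>)\<bar> \<le> ennreal (\<integral>p. \<bar>g (fst p) - g (snd p)\<bar> \<partial>\<pi>)"
    by (simp add: integral_abs_bound)
  also have "\<dots> = (\<integral>\<^sup>+ p. ennreal \<bar>g (fst p) - g (snd p)\<bar> \<partial>\<pi>)"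
    using int by (intro nn_integral_eq_integral[symmetric]) auto
  also have "\<dots> \<le> (\<integral>\<^sup>+ (x, y). ennreal (sup_dist K d x y) \<partial>\<pi>)"
    using lip by (intro nn_integral_mono) (auto simp: ennreal_leI)
  finally show "ennreal \<bar>(\<integral>x. g x \<partial>\<mu>) - (\<integral>x. g x \<partial>\<nu>)\<bar>
      \<le> (\<integral>\<^sup>+ (x, y). ennreal (sup_dist K d x y) \<partial>\<pi>)" .
qed

section \<open>The sup-norm distance on the blocks\<close>

locale block_dims =
  fixes K :: nat and d :: "nat \<Rightarrow> nat"
  assumes K_pos: "1 \<le> K" and d_pos: "\<And>k. k \<in> {1..K} \<Longrightarrow> 1 \<le> d k"
begin

lemma sup_dist_ge:
  assumes "k \<in> {1..K}" "i \<in> {1..d k}"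
  shows "\<bar>x k i - y k i\<bar> \<le> sup_dist K d x y"
  unfolding sup_dist_def using assms by (intro Max_ge) (auto intro!: image_eqI[of _ _ "(k, i)"])

lemma sup_dist_le:
  assumes "\<And>k i. k \<in> {1..K} \<Longrightarrow> i \<in> {1..d k} \<Longrightarrow> \<bar>x k i - y k i\<bar> \<le> r"
  shows "sup_dist K d x y \<le> r"
proof -
  \<comment> \<open>\<open>Max\<close> is unspecified on the empty set, so at least one coordinate
    has to exist.\<close>
  have "(1, 1) \<in> (SIGMA k:{1..K}. {1..d k})"
    using K_pos d_pos[of 1] by auto
  then have "(SIGMA k:{1..K}. {1..d k}) \<noteq> {}" by blast
  then show ?thesis
    unfolding sup_dist_def using assms by (subst Max_le_iff) auto
qed

lemma sup_dist_nonneg: "0 \<le> sup_dist K d x y"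
  using sup_dist_ge[of 1 1 x y] K_pos d_pos[of 1] by force

lemma sup_dist_refl: "sup_dist K d x x = 0"
  by (intro antisym sup_dist_nonneg sup_dist_le) simp

lemma sup_dist_commute: "sup_dist K d x y = sup_dist K d y x"
  unfolding sup_dist_def by (simp add: abs_minus_commute)

lemma sup_dist_triangle: "sup_dist K d x z \<le> sup_dist K d x y + sup_dist K d y z"
proof (rule sup_dist_le)
  fix k i assume "k \<in> {1..K}" "i \<in> {1..d k}"
  from sup_dist_ge[OF this, of x y] sup_dist_ge[OF this, of y z]
  show "\<bar>x k i - z k i\<bar> \<le> sup_dist K d x y + sup_dist K d y z" by linarith
qed

lemma measurable_coordinate:
  assumes "k \<in> {1..K}" "i \<in> {1..d k}"
  shows "(\<lambda>x. x k i) \<in> borel_measurable (blocks d {1..K})"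
proof -
  have "(\<lambda>x. x k) \<in> blocks d {1..K} \<rightarrow>\<^sub>M cube (d k)"
    unfolding blocks_def using assms by (intro measurable_component_singleton)
  moreover have "(\<lambda>y. y i) \<in> cube (d k) \<rightarrow>\<^sub>M restrict_space borel {0..1::real}"
    unfolding cube_def using assms by (intro measurable_component_singleton)
  then have "(\<lambda>y. y i) \<in> borel_measurable (cube (d k))"
    by (simp add: measurable_restrict_space2_iff)
  ultimately show ?thesis by (rule measurable_compose)
qed

lemma measurable_sup_dist: "(\<lambda>x. sup_dist K d x a) \<in> borel_measurable (blocks d {1..K})"
proof -
  have "(\<lambda>x. Max ((\<lambda>p. \<bar>x (fst p) (snd p) - a (fst p) (snd p)\<bar>) ` (SIGMA k:{1..K}. {1..d k})))
      \<in> borel_measurable (blocks d {1..K})"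
    by (intro borel_measurable_Max borel_measurable_abs borel_measurable_diff borel_measurable_const
        measurable_coordinate) auto
  then show ?thesis by (simp add: sup_dist_def case_prod_beta)
qed

text \<open>The distance to \<open>A\<close>, cut off at \<open>r\<close>; this is the test function
  for the lower bound on the Wasserstein distance. The cut makes it bounded. For empty
  \<open>A\<close>, where \<open>Min\<close> is unspecified, the distance counts as
  infinite.\<close>

definition trunc_dist :: "real \<Rightarrow> (nat \<Rightarrow> nat \<Rightarrow> real) set \<Rightarrow> (nat \<Rightarrow> nat \<Rightarrow> real) \<Rightarrow> real" where
  "trunc_dist r A x = (if A = {} then r else min r (Min ((\<lambda>a. sup_dist K d x a) ` A)))"

context
  fixes r :: real and A :: "(nat \<Rightarrow> nat \<Rightarrow> real) set" assumes r: "0 \<le> r" and A: "finite A"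
begin

lemma trunc_dist_le: "trunc_dist r A x \<le> r"
  by (simp add: trunc_dist_def)

lemma trunc_dist_ge_iff: "t \<le> trunc_dist r A x \<longleftrightarrow> t \<le> r \<and> (\<forall>a\<in>A. t \<le> sup_dist K d x a)"
  using A by (auto simp: trunc_dist_def)

lemma trunc_dist_nonneg: "0 \<le> trunc_dist r A x"
  using r by (simp add: trunc_dist_ge_iff sup_dist_nonneg)

lemma trunc_dist_mem: "a \<in> A \<Longrightarrow> trunc_dist r A a = 0"
  using trunc_dist_ge_iff[of "trunc_dist r A a" a] trunc_dist_nonneg[of a] sup_dist_refl[of a]
  by fastforce

lemma trunc_dist_far: "(\<And>a. a \<in> A \<Longrightarrow> r \<le> sup_dist K d x a) \<Longrightarrow> trunc_dist r A x = r"
  by (intro antisym trunc_dist_le) (simp add: trunc_dist_ge_iff)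

text \<open>A minimum of 1-Lipschitz functions and a constant is 1-Lipschitz. The one-sided estimate
  is checked against each term of the minimum; exchanging \<open>x\<close> and \<open>y\<close>
  gives the other side.\<close>

lemma trunc_dist_Lipschitz: "\<bar>trunc_dist r A x - trunc_dist r A y\<bar> \<le> sup_dist K d x y"
proof -
  have *: "trunc_dist r A x - sup_dist K d x y \<le> trunc_dist r A y" for x y
    unfolding trunc_dist_ge_iff
  proof (intro conjI ballI)
    show "trunc_dist r A x - sup_dist K d x y \<le> r"
      using trunc_dist_le[of x] sup_dist_nonneg[of x y] by linarith
    fix a assume "a \<in> A"
    then have "trunc_dist r A x \<le> sup_dist K d x a"
      using trunc_dist_ge_iff[of "trunc_dist r A x" x] by simp
    then show "trunc_dist r A x - sup_dist K d x y \<le> sup_dist K d y a"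
      using sup_dist_triangle[of x a y] by linarith
  qed
  show ?thesis using *[of x y] *[of y x] sup_dist_commute[of x y] by linarith
qed

lemma measurable_trunc_dist: "trunc_dist r A \<in> borel_measurable (blocks d {1..K})"
  unfolding trunc_dist_def [abs_def] using A
  by (cases "A = {}")
     (simp_all del: One_nat_def add: borel_measurable_min borel_measurable_Min measurable_sup_dist)

end

end

subsection \<open>Kernel products of finitely supported measures\<close>

lemma measurable_blocks_upd:
  "(\<lambda>(x, y). x(k := y)) \<in> blocks d S \<Otimes>\<^sub>M cube (d k) \<rightarrow>\<^sub>M blocks d (insert k S)"
  unfolding blocks_def by (rule measurable_add_dim)

lemma measurable_blocks_restrict:
  "A \<subseteq> S \<Longrightarrow> (\<lambda>x. restrict x A) \<in> blocks d S \<rightarrow>\<^sub>M blocks d A"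
  unfolding blocks_def by (rule measurable_restrict_subset)

text \<open>One more node drawn: this is \<open>bind_unif\<close> for the kernel that writes the new
  coordinate into the point already drawn.\<close>

lemma kernel_product_Cons_unif:
  assumes prev: "kernel_product d G \<kappa> ks = unif (blocks d (set ks)) S f"
    and S: "finite S" "S \<noteq> {}" "f \<in> S \<rightarrow> space (blocks d (set ks))"
    and T: "finite T" "\<And>s. s \<in> S \<Longrightarrow> g s \<in> T \<rightarrow> space (cube (d k))"
    and pa: "parents G k \<subseteq> set ks"
    and \<kappa>: "\<kappa> k \<in> blocks d (parents G k) \<rightarrow>\<^sub>M prob_algebra (cube (d k))"
      "\<And>s. s \<in> S \<Longrightarrow> \<kappa> k (restrict (f s) (parents G k)) = unif (cube (d k)) T (g s)"
  shows "kernel_product d G \<kappa> (k # ks)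
    = unif (blocks d (insert k (set ks))) (S \<times> T) (\<lambda>(s, t). (f s)(k := g s t))"
proof -
  let ?N = "\<lambda>x. distr (\<kappa> k (restrict x (parents G k))) (blocks d (insert k (set ks))) (\<lambda>y. x(k := y))"
  have \<kappa>': "(\<lambda>x. \<kappa> k (restrict x (parents G k))) \<in> blocks d (set ks) \<rightarrow>\<^sub>M prob_algebra (cube (d k))"
    using measurable_compose[OF measurable_blocks_restrict[OF pa] \<kappa>(1)] .
  have N: "?N \<in> blocks d (set ks) \<rightarrow>\<^sub>M subprob_algebra (blocks d (insert k (set ks)))"
    by (intro measurable_prob_algebraD measurable_distr_prob_space2[OF \<kappa>'] measurable_blocks_upd)
  have upd: "(\<lambda>y. (f s)(k := y)) \<in> cube (d k) \<rightarrow>\<^sub>M blocks d (insert k (set ks))" if "s \<in> S" for s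
  proof -
    have "f s \<in> space (blocks d (set ks))" using S(3) that by auto
    then have "(\<lambda>y. (f s, y)) \<in> cube (d k) \<rightarrow>\<^sub>M blocks d (set ks) \<Otimes>\<^sub>M cube (d k)" by simp
    from measurable_compose[OF this measurable_blocks_upd] show ?thesis by simp
  qed
  have Nf: "?N (f s) = unif (blocks d (insert k (set ks))) T (\<lambda>t. (f s)(k := g s t))" if "s \<in> S" for s
    using that T \<kappa>(2) upd by (simp add: distr_unif)
  have sp: "(\<lambda>t. (f s)(k := g s t)) \<in> T \<rightarrow> space (blocks d (insert k (set ks)))" if "s \<in> S" for s
    using measurable_space[OF upd[OF that]] T(2)[OF that] by auto
  show ?thesis
    unfolding kernel_product.simps prev
    by (rule bind_unif[where N = ?N and g = "\<lambda>s t. (f s)(k := g s t)"]) (fact S T(1) sp N Nf)+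
qed

text \<open>Given the index \<open>z\<close>, the index \<open>t\<close> is uniform on
  \<open>T\<close>, so coordinate \<open>k\<close> has law \<open>\<kappa> (r z)\<close>. This law
  depends on \<open>z\<close> only through the coordinates in \<open>A\<close>, hence it is also the
  law given those coordinates, even if several \<open>z\<close> share the same value
  \<open>r z\<close>.\<close>

lemma is_reg_cond_distr_unif:
  assumes \<mu>: "\<mu> = unif (blocks d S) (Z \<times> T) p"
    and fin: "finite Z" "finite T" and p: "p \<in> Z \<times> T \<rightarrow> space (blocks d S)"
    and k: "k \<in> S" and A: "A \<subseteq> S"
    and r: "\<And>z t. z \<in> Z \<Longrightarrow> t \<in> T \<Longrightarrow> restrict (p (z, t)) A = r z"
    and \<kappa>: "\<kappa> \<in> blocks d A \<rightarrow>\<^sub>M prob_algebra (cube (d k))"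
      "\<And>z. z \<in> Z \<Longrightarrow> \<kappa> (r z) = unif (cube (d k)) T (\<lambda>t. p (z, t) k)"
  shows "is_reg_cond_distr d \<mu> A k \<kappa>"
  unfolding is_reg_cond_distr_def
proof (intro conjI ballI \<kappa>(1))
  fix P Q assume P: "P \<in> sets (blocks d A)" and Q: "Q \<in> sets (cube (d k))"
  have comp: "(\<lambda>x. x k) \<in> blocks d S \<rightarrow>\<^sub>M cube (d k)"
    unfolding blocks_def using k by (rule measurable_component_singleton)
  note restr = measurable_blocks_restrict[OF A, of d]
  have pk: "(\<lambda>t. p (z, t) k) \<in> T \<rightarrow> space (cube (d k))" if "z \<in> Z" for z
    using measurable_space[OF comp] p that by auto
  have r_sp: "p s \<in> space (blocks d S)" "restrict (p s) A \<in> space (blocks d A)" if "s \<in> Z \<times> T" for s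
    using measurable_space[OF restr] p that by auto
  have meas: "{x \<in> space (blocks d S). restrict x A \<in> P \<and> x k \<in> Q} \<in> sets (blocks d S)"
  proof -
    have "{x \<in> space (blocks d S). restrict x A \<in> P \<and> x k \<in> Q}
      = ((\<lambda>x. restrict x A) -` P \<inter> space (blocks d S)) \<inter> ((\<lambda>x. x k) -` Q \<inter> space (blocks d S))" by auto
    also have "\<dots> \<in> sets (blocks d S)"
      by (intro sets.Int measurable_sets[OF restr P] measurable_sets[OF comp Q])
    finally show ?thesis .
  qed
  have em: "(\<lambda>z. emeasure (\<kappa> z) Q) \<in> borel_measurable (blocks d A)"
    using measurable_emeasure_kernel[OF measurable_prob_algebraD[OF \<kappa>(1)] Q] .
  have h: "(\<lambda>z. emeasure (\<kappa> z) Q * indicator P z) \<in> borel_measurable (blocks d A)"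
    using em P by simp
  let ?c = "ennreal (1 / card (Z \<times> T))"
  have "emeasure \<mu> {x \<in> space \<mu>. restrict x A \<in> P \<and> x k \<in> Q}
    = ennreal (card {s \<in> Z \<times> T. restrict (p s) A \<in> P \<and> p s k \<in> Q} / card (Z \<times> T))"
  proof -
    have "{s \<in> Z \<times> T. p s \<in> {x \<in> space (blocks d S). restrict x A \<in> P \<and> x k \<in> Q}}
        = {s \<in> Z \<times> T. restrict (p s) A \<in> P \<and> p s k \<in> Q}" using r_sp by auto
    then show ?thesis
      using emeasure_unif[OF _ p meas] fin by (simp add: \<mu>)
  qed
  also have "{s \<in> Z \<times> T. restrict (p s) A \<in> P \<and> p s k \<in> Q}
    = (SIGMA z:{z \<in> Z. r z \<in> P}. {t \<in> T. p (z, t) k \<in> Q})"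
    using r by auto
  also have "card \<dots> = (\<Sum>z\<in>{z \<in> Z. r z \<in> P}. card {t \<in> T. p (z, t) k \<in> Q})"
    using fin by (subst card_SigmaI) auto
  also have "\<dots> = (\<Sum>z\<in>Z. card {t \<in> T. p (z, t) k \<in> Q} * indicator P (r z))"
    unfolding sum.inter_filter[OF fin(1)] by (intro sum.cong) (auto simp: indicator_def)
  also have "ennreal (real \<dots> / card (Z \<times> T))
    = ?c * (\<Sum>z\<in>Z. ennreal (card {t \<in> T. p (z, t) k \<in> Q} * indicator P (r z)))"
    by (simp add: sum_ennreal sum_nonneg flip: ennreal_mult)
  \<comment> \<open>Writing each count as a constant sum over \<open>T\<close> produces a sum over
    \<open>Z \<times> T\<close>, the index set over which \<open>nn_integral_unif\<close>
    integrates.\<close>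
  also have "(\<Sum>z\<in>Z. ennreal (card {t \<in> T. p (z, t) k \<in> Q} * indicator P (r z)))
    = (\<Sum>z\<in>Z. \<Sum>t\<in>T. emeasure (\<kappa> (r z)) Q * indicator P (r z))"
  proof (intro sum.cong refl)
    fix z assume z: "z \<in> Z"
    have e: "emeasure (\<kappa> (r z)) Q = ennreal (card {t \<in> T. p (z, t) k \<in> Q} / card T)"
      using z fin pk Q by (simp add: \<kappa>(2) emeasure_unif)
    show "ennreal (card {t \<in> T. p (z, t) k \<in> Q} * indicator P (r z))
      = (\<Sum>t\<in>T. emeasure (\<kappa> (r z)) Q * indicator P (r z))"
      unfolding e using fin
      by (cases "T = {}") (auto simp: indicator_def ennreal_of_nat_eq_real_of_nat simp flip: ennreal_mult)
  qed
  also have "\<dots> = (\<Sum>(z, t)\<in>Z \<times> T. emeasure (\<kappa> (r z)) Q * indicator P (r z))"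
    by (rule sum.cartesian_product)
  also have "\<dots> = (\<Sum>s\<in>Z \<times> T. emeasure (\<kappa> (restrict (p s) A)) Q * indicator P (restrict (p s) A))"
    by (intro sum.cong) (auto simp: r)
  also have "?c * \<dots> = (\<integral>\<^sup>+ z\<in>P. emeasure (\<kappa> z) Q \<partial>unif (blocks d A) (Z \<times> T) (\<lambda>s. restrict (p s) A))"
    by (intro nn_integral_unif[symmetric] Pi_I r_sp(2) h finite_cartesian_product fin)
  also have "unif (blocks d A) (Z \<times> T) (\<lambda>s. restrict (p s) A) = distr \<mu> (blocks d A) (\<lambda>x. restrict x A)"
    unfolding \<mu> by (rule distr_unif[OF p restr, symmetric])
  finally show "emeasure \<mu> {x \<in> space \<mu>. restrict x A \<in> P \<and> x k \<in> Q} =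
        (\<integral>\<^sup>+ z\<in>P. emeasure (\<kappa> z) Q \<partial>distr \<mu> (blocks d A) (\<lambda>x. restrict x A))" .
qed

lemma return_eq_unif:
  assumes "x \<in> space X"
  shows "return X x = unif X {x} (\<lambda>y. y)"
proof (rule measure_eqI)
  fix A assume "A \<in> sets (return X x)"
  then have A: "A \<in> sets X" by simp
  have "{s \<in> {x}. s \<in> A} = (if x \<in> A then {x} else {})" by auto
  then show "emeasure (return X x) A = emeasure (unif X {x} (\<lambda>y. y)) A"
    using assms A by (subst emeasure_unif) auto
qed simp

lemma bij_betw_PiE_upd:
  assumes "k \<notin> I"
  shows "bij_betw (\<lambda>(z, b). z(k := b)) ((\<Pi>\<^sub>E i\<in>I. B i) \<times> B k) (\<Pi>\<^sub>E i\<in>insert k I. B i)"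
proof (rule bij_betw_byWitness[where f' = "\<lambda>x. (restrict x I, x k)"])
  show "\<forall>a\<in>Pi\<^sub>E I B \<times> B k. (restrict (case a of (z, b) \<Rightarrow> z(k := b)) I,
      (case a of (z, b) \<Rightarrow> z(k := b)) k) = a"
    using assms by (auto simp: fun_eq_iff restrict_def PiE_iff extensional_def split: if_splits)
  show "\<forall>x\<in>Pi\<^sub>E (insert k I) B. (case (restrict x I, x k) of (z, b) \<Rightarrow> z(k := b)) = x"
    by (auto simp: fun_eq_iff restrict_def PiE_iff extensional_def)
  show "(\<lambda>(z, b). z(k := b)) ` (Pi\<^sub>E I B \<times> B k) \<subseteq> Pi\<^sub>E (insert k I) B"
    by (auto simp: PiE_iff extensional_def split: if_splits)
  show "(\<lambda>x. (restrict x I, x k)) ` Pi\<^sub>E (insert k I) B \<subseteq> Pi\<^sub>E I B \<times> B k"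
    by (auto simp: PiE_iff)
qed

lemma topo_order_roots:
  assumes "distinct ks" "\<And>k. k \<in> set ks \<Longrightarrow> parents G k = {}"
  shows "topo_order G ks"
  using assms by (induction ks) auto

text \<open>A root ignores everything drawn before it, so its coordinate is independent of the
  others. This covers the first \<open>K - 1\<close> nodes of the collider graph.\<close>

lemma kernel_product_roots:
  assumes "distinct ks"
    and "\<And>k. k \<in> set ks \<Longrightarrow> parents G k = {}"
    and "\<And>k. k \<in> set ks \<Longrightarrow> finite (B k) \<and> B k \<noteq> {} \<and> B k \<subseteq> space (cube (d k))"
    and "\<And>k. k \<in> set ks \<Longrightarrow> \<kappa> k = (\<lambda>_. unif (cube (d k)) (B k) (\<lambda>b. b))"
  shows "kernel_product d G \<kappa> ks = unif (blocks d (set ks)) (\<Pi>\<^sub>E k\<in>set ks. B k) (\<lambda>x. x)"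
  using assms
proof (induction ks)
  case Nil
  then show ?case by (simp add: return_eq_unif space_blocks)
next
  case (Cons k ks)
  let ?Z = "\<Pi>\<^sub>E j\<in>set ks. B j"
  have Z: "finite ?Z" "?Z \<noteq> {}" "(\<lambda>x. x) \<in> ?Z \<rightarrow> space (blocks d (set ks))"
  proof -
    have "?Z \<subseteq> space (blocks d (set ks))"
      unfolding space_blocks using Cons.prems by (intro PiE_mono) auto
    then show "finite ?Z" "?Z \<noteq> {}" "(\<lambda>x. x) \<in> ?Z \<rightarrow> space (blocks d (set ks))"
      using Cons.prems by (auto simp: PiE_eq_empty_iff intro!: finite_PiE)
  qed
  have B: "finite (B k)" "B k \<noteq> {}" "B k \<subseteq> space (cube (d k))" using Cons.prems by auto
  have "kernel_product d G \<kappa> (k # ks)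
      = unif (blocks d (insert k (set ks))) (?Z \<times> B k) (\<lambda>(z, b). z(k := b))"
  proof (rule kernel_product_Cons_unif[OF _ Z])
    show "kernel_product d G \<kappa> ks = unif (blocks d (set ks)) ?Z (\<lambda>x. x)"
      using Cons.prems by (intro Cons.IH) auto
    show "\<kappa> k \<in> blocks d (parents G k) \<rightarrow>\<^sub>M prob_algebra (cube (d k))"
      using Cons.prems B by (auto intro!: measurable_const unif_in_prob_algebra)
    show "parents G k \<subseteq> set ks" using Cons.prems by auto
  qed (use Cons.prems(1,2,4) B in auto)
  also have "\<dots> = unif (blocks d (insert k (set ks))) (\<Pi>\<^sub>E j\<in>insert k (set ks). B j) (\<lambda>x. x)"
  proof (rule unif_reindex[symmetric, where f = "\<lambda>x. x"])
    show "finite (\<Pi>\<^sub>E j\<in>insert k (set ks). B j)"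
      using Cons.prems by (intro finite_PiE) auto
    show "bij_betw (\<lambda>(z, b). z(k := b)) (?Z \<times> B k) (\<Pi>\<^sub>E j\<in>insert k (set ks). B j)"
      using Cons.prems by (intro bij_betw_PiE_upd) simp
    have "(\<Pi>\<^sub>E j\<in>insert k (set ks). B j) \<subseteq> space (blocks d (insert k (set ks)))"
      unfolding space_blocks using Cons.prems by (intro PiE_mono) auto
    then show "(\<lambda>x. x) \<in> (\<Pi>\<^sub>E j\<in>insert k (set ks). B j) \<rightarrow> space (blocks d (insert k (set ks)))"
      by auto
  qed
  finally show ?case by simp
qed

lemma parents_collider_graph:
  "parents (collider_graph K) k = (if k = K then {1..K - 1} else {})"
  by (auto simp: parents_def collider_graph_def)

subsection \<open>Perturbed grids\<close>

locale perturbed_grid = block_dims +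
  fixes m :: nat
  assumes m_pos: "1 \<le> m"
begin

definition block_grid :: "nat \<Rightarrow> (nat \<Rightarrow> real) set" where
  "block_grid k = {1..d k} \<rightarrow>\<^sub>E (\<lambda>j. real j / m) ` {..<m}"

definition grid :: "(nat \<Rightarrow> nat \<Rightarrow> real) set" where
  "grid = (\<Pi>\<^sub>E k\<in>{1..K}. block_grid k)"

text \<open>The move is half a mesh width. The largest grid coordinate becomes
  \<open>1 - 1 / (2 * m)\<close>, so bumped blocks stay in the cube, and moved points keep their
  distance from all grid points.\<close>

definition bump :: "(nat \<Rightarrow> real) \<Rightarrow> nat \<Rightarrow> real" where
  "bump b = b(1 := b 1 + 1 / (2 * m))"

definition shift :: "(nat \<Rightarrow> nat \<Rightarrow> real) set \<Rightarrow> (nat \<Rightarrow> nat \<Rightarrow> real) \<Rightarrow> nat \<Rightarrow> nat \<Rightarrow> real" where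
  "shift s c = (if c \<in> s then c(K := bump (c K)) else c)"

definition grid_measure :: "(nat \<Rightarrow> nat \<Rightarrow> real) set \<Rightarrow> (nat \<Rightarrow> nat \<Rightarrow> real) measure" where
  "grid_measure s = unif (blocks d {1..K}) grid (shift s)"

lemma finite_block_grid: "finite (block_grid k)"
  unfolding block_grid_def by (intro finite_PiE) auto

lemma block_grid_nonempty: "block_grid k \<noteq> {}"
proof -
  have "0 \<in> {..<m}" using m_pos by simp
  then show ?thesis unfolding block_grid_def PiE_eq_empty_iff by blast
qed

lemma card_block_grid: "card (block_grid k) = m ^ d k"
proof -
  have "inj_on (\<lambda>j. real j / m) {..<m}" using m_pos by (auto simp: inj_on_def)
  then show ?thesis by (simp add: block_grid_def card_PiE card_image)
qed

lemma finite_grid: "finite grid"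
  unfolding grid_def by (intro finite_PiE finite_block_grid) auto

lemma grid_nonempty: "grid \<noteq> {}"
  unfolding grid_def using block_grid_nonempty by (auto simp: PiE_eq_empty_iff)

lemma card_grid: "card grid = m ^ (\<Sum>k = 1..K. d k)"
  by (simp add: grid_def card_PiE card_block_grid power_sum)

lemma block_grid_coordinate:
  assumes "b \<in> block_grid k" "i \<in> {1..d k}"
  obtains j where "j < m" "b i = real j / m"
proof -
  have "b i \<in> (\<lambda>j. real j / m) ` {..<m}"
    using assms unfolding block_grid_def by (rule PiE_mem)
  then show ?thesis using that by auto
qed

lemma block_grid_subset: "block_grid k \<subseteq> space (cube (d k))"
  unfolding block_grid_def space_cube by (intro PiE_mono) auto

lemma bump_in_cube:
  assumes "b \<in> block_grid k" "k \<in> {1..K}"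
  shows "bump b \<in> space (cube (d k))"
proof -
  have k: "1 \<in> {1..d k}" using d_pos[OF assms(2)] by simp
  obtain j where j: "j < m" "b 1 = real j / m" using block_grid_coordinate[OF assms(1) k] .
  have "real j + 1 / 2 \<le> m" using j by linarith
  then have "b 1 + 1 / (2 * m) \<le> 1" using m_pos by (simp add: j(2) field_simps del: One_nat_def)
  moreover have "0 \<le> b 1" by (simp add: j(2) del: One_nat_def)
  moreover have "b \<in> space (cube (d k))" using block_grid_subset assms by auto
  ultimately show ?thesis
    using k by (auto simp: bump_def space_cube PiE_iff extensional_def)
qed

lemma grid_block: "c \<in> grid \<Longrightarrow> k \<in> {1..K} \<Longrightarrow> c k \<in> block_grid k"
  by (auto simp: grid_def)

lemma shift_in_blocks:
  assumes "c \<in> grid"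
  shows "shift s c \<in> space (blocks d {1..K})"
proof -
  have "c \<in> space (blocks d {1..K})"
    using assms block_grid_subset unfolding grid_def space_blocks by (meson PiE_mono subsetD)
  moreover have "bump (c K) \<in> space (cube (d K))"
    using assms K_pos by (intro bump_in_cube grid_block) auto
  ultimately show ?thesis
    using K_pos by (auto simp: shift_def space_blocks PiE_iff extensional_def)
qed

lemma shift_funcset: "shift s \<in> grid \<rightarrow> space (blocks d {1..K})"
  using shift_in_blocks by auto

text \<open>If the points coincide, exactly one of them is moved, by \<open>1 / (2 * m)\<close>. If
  they differ, some coordinates are at least \<open>1 / m\<close> apart; both displacements
  \<open>e\<close> and \<open>e'\<close> lie between 0 and \<open>1 / (2 * m)\<close>, so they
  reduce this gap by at most half.\<close>

lemma sup_dist_shift_ge: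
  assumes c: "c \<in> grid" "c' \<in> grid" and ne: "c \<noteq> c' \<or> (c \<in> s \<longleftrightarrow> c' \<notin> s')"
  shows "1 / (2 * real m) \<le> sup_dist K d (shift s c) (shift s' c')"
proof (cases "c = c'")
  case True
  have "1 \<in> {1..d K}" "K \<in> {1..K}" using K_pos d_pos[of K] by auto
  from sup_dist_ge[OF this(2,1), of "shift s c" "shift s' c'"] True ne m_pos
  show ?thesis by (auto simp: shift_def bump_def split: if_splits)
next
  case False
  then obtain k where k: "k \<in> {1..K}" "c k \<noteq> c' k"
    using c unfolding grid_def by (metis PiE_ext)
  then obtain i where i: "i \<in> {1..d k}" "c k i \<noteq> c' k i"
    using grid_block[OF c(1) k(1)] grid_block[OF c(2) k(1)] unfolding block_grid_def by (metis PiE_ext)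
  obtain j where j: "c k i = real j / m"
    using block_grid_coordinate[OF grid_block[OF c(1) k(1)] i(1)] .
  obtain j' where j': "c' k i = real j' / m"
    using block_grid_coordinate[OF grid_block[OF c(2) k(1)] i(1)] .
  define e where "e = shift s c k i - c k i"
  define e' where "e' = shift s' c' k i - c' k i"
  define \<delta> where "\<delta> = 1 / (2 * real m)"
  have e: "0 \<le> e" "e \<le> \<delta>" "0 \<le> e'" "e' \<le> \<delta>"
    by (auto simp: e_def e'_def shift_def bump_def \<delta>_def)
  have "j \<noteq> j'" using i j j' by auto
  then have "1 \<le> \<bar>real j - real j'\<bar>" by linarith
  then have "1 / real m \<le> \<bar>c k i - c' k i\<bar>"
    using m_pos by (simp add: j j' abs_divide divide_right_mono flip: diff_divide_distrib)
  moreover have "1 / real m = 2 * \<delta>" using m_pos by (simp add: \<delta>_def)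
  ultimately have "\<delta> \<le> \<bar>(c k i + e) - (c' k i + e')\<bar>"
    using e by linarith
  also have "(c k i + e) - (c' k i + e') = shift s c k i - shift s' c' k i"
    by (simp add: e_def e'_def)
  also have "\<bar>\<dots>\<bar> \<le> sup_dist K d (shift s c) (shift s' c')"
    by (rule sup_dist_ge[OF k(1) i(1)])
  finally show ?thesis unfolding \<delta>_def .
qed

section \<open>The grid measures belong to the collider model\<close>

lemma grid_measure_split:
  assumes "k \<in> {1..K}"
  shows "grid_measure s = unif (blocks d {1..K})
    ((\<Pi>\<^sub>E j\<in>{1..K} - {k}. block_grid j) \<times> block_grid k) (\<lambda>(z, b). shift s (z(k := b)))"
proof -
  have "insert k ({1..K} - {k}) = {1..K}" using assms by auto
  then have "bij_betw (\<lambda>(z, b). z(k := b))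
      ((\<Pi>\<^sub>E j\<in>{1..K} - {k}. block_grid j) \<times> block_grid k) grid"
    using bij_betw_PiE_upd[of k "{1..K} - {k}" block_grid] by (simp add: grid_def)
  from unif_reindex[OF finite_grid this shift_funcset[of s]]
  show ?thesis unfolding grid_measure_def by (rule trans) (auto intro!: unif_cong)
qed

text \<open>Roots keep the uniform law on their block grid because \<open>shift\<close> leaves their
  blocks alone. For the last node, parent values off the grid form a null set; the law chosen there
  only has to be a probability measure.\<close>

definition cond_kernel ::
    "(nat \<Rightarrow> nat \<Rightarrow> real) set \<Rightarrow> nat \<Rightarrow> (nat \<Rightarrow> nat \<Rightarrow> real) \<Rightarrow> (nat \<Rightarrow> real) measure" where
  "cond_kernel s k = (if k = K
     then (\<lambda>z. if z \<in> (\<Pi>\<^sub>E j\<in>{1..K - 1}. block_grid j)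
               then unif (cube (d K)) (block_grid K) (\<lambda>b. shift s (z(K := b)) K)
               else unif (cube (d K)) (block_grid K) (\<lambda>b. b))
     else (\<lambda>_. unif (cube (d k)) (block_grid k) (\<lambda>b. b)))"

lemma upd_in_grid:
  assumes "k \<in> {1..K}" "z \<in> (\<Pi>\<^sub>E j\<in>{1..K} - {k}. block_grid j)" "b \<in> block_grid k"
  shows "z(k := b) \<in> grid"
proof -
  have "z(k := b) \<in> (\<Pi>\<^sub>E j\<in>insert k ({1..K} - {k}). block_grid j)"
    using assms by (intro PiE_fun_upd)
  then show ?thesis using assms(1) by (simp add: grid_def insert_absorb)
qed

lemma last_block: "{1..K} - {K} = {1..K - 1}" "insert K {1..K - 1} = {1..K}"
  using K_pos by auto

lemma shift_block_in_cube: "c \<in> grid \<Longrightarrow> k \<in> {1..K} \<Longrightarrow> shift s c k \<in> space (cube (d k))"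
  using shift_in_blocks[of c s] by (auto simp: space_blocks)

lemma unif_block_grid_in_prob_algebra:
  "unif (cube (d k)) (block_grid k) (\<lambda>b. b) \<in> space (prob_algebra (cube (d k)))"
  using block_grid_subset by (intro unif_in_prob_algebra finite_block_grid block_grid_nonempty) auto

lemma measurable_cond_kernel:
  assumes "k \<in> {1..K}"
  shows "cond_kernel s k \<in> blocks d (parents (collider_graph K) k) \<rightarrow>\<^sub>M prob_algebra (cube (d k))"
proof (cases "k = K")
  case True
  have sub: "(\<Pi>\<^sub>E j\<in>{1..K - 1}. block_grid j) \<subseteq> space (blocks d {1..K - 1})"
    unfolding space_blocks by (intro PiE_mono block_grid_subset)
  have "(\<lambda>z. if z \<in> (\<Pi>\<^sub>E j\<in>{1..K - 1}. block_grid j)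
       then unif (cube (d K)) (block_grid K) (\<lambda>b. shift s (z(K := b)) K)
       else unif (cube (d K)) (block_grid K) (\<lambda>b. b)) \<in> blocks d {1..K - 1} \<rightarrow>\<^sub>M prob_algebra (cube (d K))"
  proof (rule measurable_finite_cases)
    show "finite (\<Pi>\<^sub>E j\<in>{1..K - 1}. block_grid j)"
      by (intro finite_PiE finite_block_grid) auto
    fix z assume z: "z \<in> (\<Pi>\<^sub>E j\<in>{1..K - 1}. block_grid j)"
    then show "{z} \<in> sets (blocks d {1..K - 1})"
      using sub by (intro singleton_sets_blocks) auto
    show "unif (cube (d K)) (block_grid K) (\<lambda>b. shift s (z(K := b)) K) \<in> space (prob_algebra (cube (d K)))"
      using K_pos z[folded last_block(1)]
      by (intro unif_in_prob_algebra finite_block_grid block_grid_nonempty Pi_I shift_block_in_cube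
          upd_in_grid) auto
  qed (rule unif_block_grid_in_prob_algebra)
  then show ?thesis
    using True by (simp add: cond_kernel_def parents_collider_graph)
next
  case False
  then show ?thesis
    by (simp add: cond_kernel_def unif_block_grid_in_prob_algebra)
qed

text \<open>The head of the list is drawn last: first the roots, in any order, independently and
  uniformly, then block \<open>K\<close> given all of them.\<close>

lemma grid_measure_eq_kernel_product:
  assumes ks: "distinct ks" "set ks = {1..K - 1}"
  shows "grid_measure s = kernel_product d (collider_graph K) (cond_kernel s) (K # ks)"
proof -
  let ?Z = "\<Pi>\<^sub>E j\<in>{1..K - 1}. block_grid j"
  have nK: "k \<noteq> K" if "k \<in> set ks" for k using that K_pos ks by auto
  have pa: "parents (collider_graph K) k = {}" if "k \<in> set ks" for k
    using nK[OF that] by (simp add: parents_collider_graph)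
  have prev: "kernel_product d (collider_graph K) (cond_kernel s) ks = unif (blocks d (set ks)) ?Z (\<lambda>x. x)"
    unfolding ks(2)[symmetric]
    by (rule kernel_product_roots[OF ks(1) pa])
       (use nK finite_block_grid block_grid_nonempty block_grid_subset in \<open>auto simp: cond_kernel_def\<close>)
  have sub: "?Z \<subseteq> space (blocks d (set ks))"
    unfolding space_blocks ks by (intro PiE_mono block_grid_subset)
  have up: "z(K := b) \<in> grid" if "z \<in> ?Z" "b \<in> block_grid K" for z b
    using upd_in_grid[of K z b] that K_pos unfolding last_block(1) by simp
  have "kernel_product d (collider_graph K) (cond_kernel s) (K # ks)
    = unif (blocks d (insert K (set ks))) (?Z \<times> block_grid K)
       (\<lambda>(z, b). z(K := shift s (z(K := b)) K))"
  proof (rule kernel_product_Cons_unif[OF prev])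
    show "finite ?Z" "?Z \<noteq> {}"
      using block_grid_nonempty by (auto intro!: finite_PiE finite_block_grid simp: PiE_eq_empty_iff)
    show "(\<lambda>x. x) \<in> ?Z \<rightarrow> space (blocks d (set ks))" using sub by auto
    show "finite (block_grid K)" by (rule finite_block_grid)
    show "parents (collider_graph K) K \<subseteq> set ks" by (simp add: ks parents_collider_graph)
    show "cond_kernel s K \<in> blocks d (parents (collider_graph K) K) \<rightarrow>\<^sub>M prob_algebra (cube (d K))"
      using K_pos by (intro measurable_cond_kernel) auto
    fix z assume z: "z \<in> ?Z"
    show "(\<lambda>b. shift s (z(K := b)) K) \<in> block_grid K \<rightarrow> space (cube (d K))"
      using up[OF z] K_pos by (auto intro!: shift_block_in_cube)
    have "restrict z {1..K - 1} = z" using z by (rule PiE_restrict)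
    then show "cond_kernel s K (restrict z (parents (collider_graph K) K))
        = unif (cube (d K)) (block_grid K) (\<lambda>b. shift s (z(K := b)) K)"
      using z by (simp add: cond_kernel_def parents_collider_graph)
  qed
  \<comment> \<open>\<open>shift\<close> changes no block but \<open>K\<close>, so inserting the
    shifted last block into \<open>z\<close> gives the whole shifted point.\<close>
  also have "\<dots> = unif (blocks d {1..K}) (?Z \<times> block_grid K) (\<lambda>(z, b). shift s (z(K := b)))"
    unfolding ks last_block(2)
    by (rule unif_cong) (auto simp: shift_def)
  also have "\<dots> = grid_measure s"
    using grid_measure_split[of K s] K_pos unfolding last_block(1) by simp
  finally show ?thesis by simp
qed

text \<open>Splitting off block \<open>k\<close> makes \<open>z\<close> the tuple of all other
  blocks. For \<open>k = K\<close> these are exactly the parents. For a root nothing is conditioned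
  on, and block \<open>k\<close> is uniform on its grid for every \<open>z\<close>.\<close>

lemma is_reg_cond_distr_grid_measure:
  assumes k: "k \<in> {1..K}"
  shows "is_reg_cond_distr d (grid_measure s) (parents (collider_graph K) k) k (cond_kernel s k)"
proof (rule is_reg_cond_distr_unif[OF grid_measure_split[OF k]])
  let ?Z = "\<Pi>\<^sub>E j\<in>{1..K} - {k}. block_grid j"
  show "finite ?Z" "finite (block_grid k)"
    by (auto intro!: finite_PiE finite_block_grid)
  show "(\<lambda>(z, b). shift s (z(k := b))) \<in> ?Z \<times> block_grid k \<rightarrow> space (blocks d {1..K})"
    using shift_in_blocks upd_in_grid[OF k] by auto
  show "k \<in> {1..K}" "parents (collider_graph K) k \<subseteq> {1..K}"
    using k by (auto simp: parents_collider_graph)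
  show "cond_kernel s k \<in> blocks d (parents (collider_graph K) k) \<rightarrow>\<^sub>M prob_algebra (cube (d k))"
    by (rule measurable_cond_kernel[OF k])
  fix z assume z: "z \<in> ?Z"
  show "restrict (case (z, b) of (z, b) \<Rightarrow> shift s (z(k := b))) (parents (collider_graph K) k)
      = restrict z (parents (collider_graph K) k)" if "b \<in> block_grid k" for b
    by (auto simp: parents_collider_graph shift_def fun_eq_iff)
  show "cond_kernel s k (restrict z (parents (collider_graph K) k))
      = unif (cube (d k)) (block_grid k) (\<lambda>b. (case (z, b) of (z, b) \<Rightarrow> shift s (z(k := b))) k)"
  proof (cases "k = K")
    case True
    then have z': "z \<in> (\<Pi>\<^sub>E j\<in>{1..K - 1}. block_grid j)" using z unfolding last_block(1)[symmetric] by simp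
    then have "restrict z {1..K - 1} = z" by (rule PiE_restrict)
    then show ?thesis using z' True by (simp add: cond_kernel_def parents_collider_graph)
  next
    case False
    then show ?thesis by (auto simp: cond_kernel_def shift_def intro!: unif_cong)
  qed
qed

lemma grid_measure_in_graph_measures:
  "grid_measure s \<in> graph_measures K d (collider_graph K)"
proof -
  obtain ks where ks: "set ks = {1..K - 1}" "distinct ks"
    using finite_distinct_list[of "{1..K - 1}"] by auto
  have "K \<notin> set ks" using K_pos ks by auto
  then have "topo_order (collider_graph K) (K # ks)"
    using ks by (auto simp: parents_collider_graph intro!: topo_order_roots)
  moreover have "set (K # ks) = {1..K}" using ks last_block(2) by simp
  moreover have "grid_measure s \<in> space (prob_algebra (blocks d {1..K}))"
    unfolding grid_measure_def
    by (intro unif_in_prob_algebra finite_grid grid_nonempty shift_funcset)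
  ultimately show ?thesis
    using is_reg_cond_distr_grid_measure grid_measure_eq_kernel_product[OF ks(2,1)]
    unfolding graph_measures_def by blast
qed

subsection \<open>Flipping the unobserved grid points\<close>

text \<open>The tuple \<open>\<omega>\<close> holds the grid points before the shift, so its law
  does not depend on \<open>s\<close>; the observations depend on \<open>s\<close> through
  \<open>shift\<close> alone.\<close>

definition sample :: "nat \<Rightarrow> (nat \<Rightarrow> nat \<Rightarrow> real) set \<Rightarrow> (nat \<Rightarrow> nat \<Rightarrow> nat \<Rightarrow> real)
    \<Rightarrow> nat \<Rightarrow> nat \<Rightarrow> nat \<Rightarrow> real" where
  "sample n s \<omega> = (\<lambda>i\<in>{1..n}. shift s (\<omega> i))"

text \<open>For fixed \<open>\<omega>\<close> the set of unobserved points is the same for all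
  \<open>s\<close>. Hence flipping is an involution and permutes the subsets of the grid.\<close>

definition flip :: "nat \<Rightarrow> (nat \<Rightarrow> nat \<Rightarrow> nat \<Rightarrow> real) \<Rightarrow> (nat \<Rightarrow> nat \<Rightarrow> real) set
    \<Rightarrow> (nat \<Rightarrow> nat \<Rightarrow> real) set" where
  "flip n \<omega> s = sym_diff s (grid - \<omega> ` {1..n})"

lemma sample_flip:
  assumes "\<omega> \<in> {1..n} \<rightarrow>\<^sub>E grid"
  shows "sample n (flip n \<omega> s) \<omega> = sample n s \<omega>"
  using assms by (auto simp: sample_def flip_def shift_def fun_eq_iff)

lemma bij_betw_flip: "bij_betw (flip n \<omega>) (Pow grid) (Pow grid)"
  by (rule bij_betw_byWitness[where f' = "flip n \<omega>"]) (auto simp: flip_def)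

text \<open>The test function is the distance to the \<open>s\<close>-positions of the unobserved
  points \<open>J\<close>, cut off at \<open>r\<close>. On \<open>J\<close> it is 0 before the flip
  and \<open>r\<close> after it; the other points do not move. As \<open>J\<close> is at least half
  of the grid, the two integrals differ by at least \<open>r / 2\<close>.\<close>

lemma wasserstein_flip_ge:
  assumes \<omega>: "\<omega> \<in> {1..n} \<rightarrow>\<^sub>E grid" and size: "2 * n \<le> card grid"
  shows "ennreal (1 / (4 * real m))
    \<le> wasserstein K d \<mu> (grid_measure s) + wasserstein K d \<mu> (grid_measure (flip n \<omega> s))"
proof -
  define J where "J = grid - \<omega> ` {1..n}"
  define r where "r = 1 / (2 * real m)"
  define A where "A = shift s ` J"
  let ?s' = "flip n \<omega> s"
  let ?g = "trunc_dist r A"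
  let ?I = "\<lambda>\<nu>. \<integral>x. ?g x \<partial>\<nu>"
  have J: "finite J" "J \<subseteq> grid" using finite_grid by (auto simp: J_def)
  have r: "0 \<le> r" and A: "finite A" using J by (auto simp: r_def A_def)
  note td = trunc_dist_le[OF r A] trunc_dist_nonneg[OF r A] trunc_dist_mem[OF r A]
    trunc_dist_far[OF r A] trunc_dist_Lipschitz[OF r A] measurable_trunc_dist[OF r A]
  have W: "ennreal \<bar>?I \<mu> - ?I \<nu>\<bar> \<le> wasserstein K d \<mu> \<nu>" for \<nu>
    by (rule wasserstein_ge_Lipschitz[where B = r]) (use td in auto)
  have I: "?I (grid_measure t) = (\<Sum>c\<in>grid. ?g (shift t c)) / card grid" for t
    unfolding grid_measure_def by (intro integral_unif finite_grid shift_funcset td)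
  have diff: "?g (shift ?s' c) - ?g (shift s c) = (if c \<in> J then r else 0)" if c: "c \<in> grid" for c
  proof (cases "c \<in> J")
    case True
    \<comment> \<open>After the flip, \<open>c\<close> is far from every point of \<open>A\<close>:
      from the old position of \<open>c\<close> because its membership changed, and from the old
      positions of other points because the grid points differ.\<close>
    have "?g (shift ?s' c) = r"
    proof (rule td(4))
      fix a assume "a \<in> A"
      then obtain c' where c': "c' \<in> J" "a = shift s c'" by (auto simp: A_def)
      have "c \<noteq> c' \<or> (c \<in> ?s' \<longleftrightarrow> c' \<notin> s)" using True by (auto simp: flip_def J_def)
      then show "r \<le> sup_dist K d (shift ?s' c) a"
        using sup_dist_shift_ge[of c c' ?s' s] c c' J by (auto simp: r_def)
    qed
    moreover have "?g (shift s c) = 0" using True by (intro td(3)) (auto simp: A_def)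
    ultimately show ?thesis using True by simp
  next
    case False
    then have "shift ?s' c = shift s c" by (auto simp: shift_def flip_def J_def)
    then show ?thesis using False by simp
  qed
  \<comment> \<open>A sample of size \<open>n\<close> hits at most \<open>n\<close> grid points, and
    \<open>n\<close> is at most half of the grid.\<close>
  have "card grid - n \<le> card J"
  proof -
    have "card grid - card (\<omega> ` {1..n}) \<le> card J" unfolding J_def by (rule diff_card_le_card_Diff) simp
    moreover have "card (\<omega> ` {1..n}) \<le> n" using card_image_le[of "{1..n}" \<omega>] by simp
    ultimately show ?thesis by linarith
  qed
  then have half: "real (card grid) \<le> 2 * real (card J)" using size by linarith
  have N: "0 < card grid" using finite_grid grid_nonempty by (simp add: card_gt_0_iff)
  have "?I (grid_measure ?s') - ?I (grid_measure s)
      = (\<Sum>c\<in>grid. ?g (shift ?s' c) - ?g (shift s c)) / card grid"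
    unfolding I by (simp add: sum_subtractf diff_divide_distrib)
  also have "(\<Sum>c\<in>grid. ?g (shift ?s' c) - ?g (shift s c)) = (\<Sum>c\<in>grid. if c \<in> J then r else 0)"
    by (intro sum.cong refl diff)
  also have "\<dots> = card J * r"
    using finite_grid J by (simp add: sum.If_cases inf.absorb2)
  finally have gap: "?I (grid_measure ?s') - ?I (grid_measure s) = card J * r / card grid" .
  have "1 / (4 * real m) = r / 2" by (simp add: r_def)
  also have "r / 2 \<le> card J * r / card grid"
    using mult_right_mono[OF half r] N by (simp add: field_simps)
  \<comment> \<open>The triangle inequality is applied to real integrals of the test function, with
    the integral under the arbitrary measure \<open>\<mu>\<close> in the middle, rather than to
    \<open>wasserstein\<close> itself.\<close>
  also have "\<dots> \<le> \<bar>?I \<mu> - ?I (grid_measure s)\<bar> + \<bar>?I \<mu> - ?I (grid_measure ?s')\<bar>"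
    using gap by linarith
  finally have "ennreal (1 / (4 * real m))
      \<le> ennreal (\<bar>?I \<mu> - ?I (grid_measure s)\<bar> + \<bar>?I \<mu> - ?I (grid_measure ?s')\<bar>)"
    by (rule ennreal_leI)
  also have "\<dots> = ennreal \<bar>?I \<mu> - ?I (grid_measure s)\<bar> + ennreal \<bar>?I \<mu> - ?I (grid_measure ?s')\<bar>"
    by (simp only: ennreal_plus abs_ge_zero)
  also have "\<dots> \<le> wasserstein K d \<mu> (grid_measure s) + wasserstein K d \<mu> (grid_measure ?s')"
    by (intro add_mono W)
  finally show ?thesis .
qed

text \<open>Expresses a lower bound on the risk as an average over index tuples whose weights do not
  depend on \<open>s\<close>, so that sums over \<open>s\<close> and over tuples can be
  exchanged.\<close>

lemma risk_grid_measure_ge: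
  "ennreal (1 / card ({1..n} \<rightarrow>\<^sub>E grid))
      * (\<Sum>\<omega>\<in>{1..n} \<rightarrow>\<^sub>E grid. wasserstein K d (E (sample n s \<omega>)) (grid_measure s))
    \<le> (\<integral>\<^sup>+ \<omega>. wasserstein K d (E \<omega>) (grid_measure s) \<partial>(\<Pi>\<^sub>M i\<in>{1..n}. grid_measure s))"
proof -
  have P: "(\<Pi>\<^sub>M i\<in>{1..n}. grid_measure s)
      = unif (\<Pi>\<^sub>M i\<in>{1..n}. blocks d {1..K}) ({1..n} \<rightarrow>\<^sub>E grid) (sample n s)"
    unfolding grid_measure_def sample_def
    by (intro PiM_unif finite_grid grid_nonempty shift_funcset finite_atLeastAtMost)
  have sp: "shift s (\<omega> i) \<in> space (blocks d {1..K})"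
    if "\<omega> \<in> {1..n} \<rightarrow>\<^sub>E grid" "i \<in> {1..n}" for \<omega> i
    using that by (intro shift_in_blocks) auto
  show ?thesis
    unfolding P
  proof (rule nn_integral_unif_ge)
    show "finite ({1..n} \<rightarrow>\<^sub>E grid)" by (intro finite_PiE finite_grid) auto
    show "sample n s \<in> ({1..n} \<rightarrow>\<^sub>E grid) \<rightarrow> space (\<Pi>\<^sub>M i\<in>{1..n}. blocks d {1..K})"
      using sp by (auto simp: space_PiM sample_def)
    fix \<omega> assume "\<omega> \<in> {1..n} \<rightarrow>\<^sub>E grid"
    then show "{sample n s \<omega>} \<in> sets (\<Pi>\<^sub>M i\<in>{1..n}. blocks d {1..K})"
      using sp by (intro singleton_sets_PiM singleton_sets_blocks) (auto simp: sample_def)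
  qed
qed

text \<open>The supremum dominates the average of the risks over all subsets \<open>s\<close> of the
  grid. For a fixed tuple, the losses at \<open>s\<close> and at its flip involve the same estimate
  and add up to at least \<open>1 / (4 * m)\<close>, so the average loss is at least half of
  that.\<close>

lemma minimax_risk_ge:
  assumes size: "2 * n \<le> card grid"
  shows "ennreal (1 / (8 * real m))
    \<le> (SUP \<mu>\<in>graph_measures K d (collider_graph K).
         \<integral>\<^sup>+ \<omega>. wasserstein K d (E \<omega>) \<mu> \<partial>(\<Pi>\<^sub>M i\<in>{1..n}. \<mu>))"
    (is "_ \<le> ?V")
proof -
  let ?\<Omega> = "{1..n} \<rightarrow>\<^sub>E grid" and ?S = "Pow grid"
  let ?W = "\<lambda>s \<omega>. wasserstein K d (E (sample n s \<omega>)) (grid_measure s)"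
  let ?e = "ennreal (1 / (4 * real m))"
  have \<Omega>: "finite ?\<Omega>" by (intro finite_PiE finite_grid) auto
  have \<Omega>0: "0 < card ?\<Omega>" using \<Omega> grid_nonempty by (simp add: card_gt_0_iff PiE_eq_empty_iff)
  have S: "finite ?S" using finite_grid by simp
  have S0: "0 < card ?S" using finite_grid by (simp add: card_Pow)
  have "of_nat (card ?S) * (ennreal (card ?\<Omega>) * ?e) = (\<Sum>\<omega>\<in>?\<Omega>. \<Sum>s\<in>?S. ?e)"
    by (simp add: ennreal_of_nat_eq_real_of_nat mult.left_commute)
  also have "\<dots> \<le> (\<Sum>\<omega>\<in>?\<Omega>. \<Sum>s\<in>?S. ?W s \<omega> + ?W (flip n \<omega> s) \<omega>)"
  proof (intro sum_mono)
    fix \<omega> s assume \<omega>: "\<omega> \<in> ?\<Omega>"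
    show "?e \<le> ?W s \<omega> + ?W (flip n \<omega> s) \<omega>"
      using wasserstein_flip_ge[OF \<omega> size] by (simp only: sample_flip[OF \<omega>])
  qed
  also have "\<dots> = (\<Sum>\<omega>\<in>?\<Omega>. 2 * (\<Sum>s\<in>?S. ?W s \<omega>))"
  proof (intro sum.cong refl)
    fix \<omega>
    \<comment> \<open>Replacing \<open>s\<close> by its flip merely permutes the summands, so both
      halves of the sum are equal.\<close>
    have "(\<Sum>s\<in>?S. ?W (flip n \<omega> s) \<omega>) = (\<Sum>s\<in>?S. ?W s \<omega>)"
      by (rule sum.reindex_bij_betw[OF bij_betw_flip])
    then show "(\<Sum>s\<in>?S. ?W s \<omega> + ?W (flip n \<omega> s) \<omega>) = 2 * (\<Sum>s\<in>?S. ?W s \<omega>)"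
      by (simp add: sum.distrib mult_2)
  qed
  also have "\<dots> = 2 * (\<Sum>s\<in>?S. \<Sum>\<omega>\<in>?\<Omega>. ?W s \<omega>)"
    unfolding sum_distrib_left[symmetric] by (subst sum.swap) (rule refl)
  also have "\<dots> \<le> 2 * (\<Sum>s\<in>?S. ennreal (card ?\<Omega>) * ?V)"
  proof (intro mult_left_mono sum_mono)
    fix s
    have "(\<Sum>\<omega>\<in>?\<Omega>. ?W s \<omega>) = ennreal (card ?\<Omega>) * (ennreal (1 / card ?\<Omega>) * (\<Sum>\<omega>\<in>?\<Omega>. ?W s \<omega>))"
      using \<Omega>0 by (simp add: mult.assoc[symmetric] flip: ennreal_mult)
    also have "\<dots> \<le> ennreal (card ?\<Omega>) * ?V"
      by (intro mult_left_mono order_trans[OF risk_grid_measure_ge]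
          SUP_upper2[OF grid_measure_in_graph_measures]) auto
    finally show "(\<Sum>\<omega>\<in>?\<Omega>. ?W s \<omega>) \<le> ennreal (card ?\<Omega>) * ?V" .
  qed simp
  also have "\<dots> = of_nat (card ?S) * (ennreal (card ?\<Omega>) * (2 * ?V))"
    by (simp add: mult_ac)
  \<comment> \<open>Cancelling in \<open>ennreal\<close> is legitimate because both cardinalities
    are positive and finite.\<close>
  finally have le: "?e \<le> 2 * ?V"
    using S0 \<Omega>0 by (simp add: ennreal_mult_le_mult_iff ennreal_of_nat_eq_real_of_nat)
  have "ennreal (1 / (8 * real m)) = ennreal (1 / 2) * ?e"
    by (subst ennreal_mult[symmetric]) auto
  also have "\<dots> \<le> ennreal (1 / 2) * (2 * ?V)"
    using le by (rule mult_left_mono) simp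
  also have "\<dots> = ?V"
  proof -
    have "ennreal (1 / 2) * 2 = 1" using ennreal_mult[of "1 / 2" 2] by simp
    then show ?thesis by (simp only: mult.assoc[symmetric] mult_1)
  qed
  finally show ?thesis .
qed

end

section \<open>Choice of the mesh width and the absolute constant\<close>

theorem proposition4p4:
  "\<exists>C::real. C > 0 \<and>
     (\<forall>(K::nat) (d::nat \<Rightarrow> nat) (n::nat).
        K \<ge> 3 \<longrightarrow> (\<forall>k\<in>{1..K}. d k \<ge> 1) \<longrightarrow> n \<ge> 1 \<longrightarrow>
        (INF E\<in>estimators K d n. SUP \<mu>\<in>graph_measures K d (collider_graph K).
           \<integral>\<^sup>+ \<omega>. wasserstein K d (E \<omega>) \<mu> \<partial>(\<Pi>\<^sub>M i\<in>{1..n}. \<mu>))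
        \<ge> ennreal (C * real n powr (- 1 / real (\<Sum>k = 1..K. d k))))"
\<comment> \<open>The constant is \<open>1 / (8 * 2 * 2)\<close>: 8 from
  \<open>minimax_risk_ge\<close>, one factor 2 from rounding \<open>x\<close> up to
  \<open>m\<close>, and one from \<open>2 powr (1 / D) \<le> 2\<close>.\<close>
proof (intro exI[of _ "1 / 32"] conjI allI impI)
  fix K :: nat and d :: "nat \<Rightarrow> nat" and n :: nat
  assume K: "3 \<le> K" and d: "\<forall>k\<in>{1..K}. 1 \<le> d k" and n: "1 \<le> n"
  define D where "D = (\<Sum>k = 1..K. d k)"
  have "d 1 \<le> D" unfolding D_def using K by (intro member_le_sum) auto
  then have D: "1 \<le> D" using bspec[OF d, of 1] K by auto
  define x where "x = real (2 * n) powr (1 / D)"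
  \<comment> \<open>The least mesh number with \<open>m ^ D \<ge> 2 * n\<close>. Since
    \<open>x \<ge> 1\<close>, rounding up at most doubles it.\<close>
  define m where "m = nat \<lceil>x\<rceil>"
  have x: "1 \<le> x" unfolding x_def using n D by (intro ge_one_powr_ge_zero) auto
  have m: "x \<le> m" "m \<le> 2 * x" using x unfolding m_def by linarith+
  interpret perturbed_grid K d m
    using K d m x by unfold_locales (auto simp: Suc_le_eq)
  have "real (2 * n) = x ^ D"
    unfolding x_def using n D by (simp add: powr_realpow[symmetric] powr_powr)
  also have "\<dots> \<le> real m ^ D" using m x by (intro power_mono) auto
  finally have size: "2 * n \<le> card grid" by (simp add: card_grid D_def flip: of_nat_power)
  \<comment> \<open>Bounding this factor uniformly in \<open>D\<close> keeps the constant
    independent of the dimension.\<close>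
  have "2 powr (1 / D) \<le> 2 powr (1 :: real)" using D by (intro powr_mono) auto
  then have "x \<le> 2 * real n powr (1 / D)"
    unfolding x_def by (simp add: powr_mult mult_right_mono)
  then have "8 * real m \<le> 32 * real n powr (1 / D)" using m by linarith
  then have "1 / (32 * real n powr (1 / D)) \<le> 1 / (8 * real m)"
    using m x n by (intro divide_left_mono mult_pos_pos) auto
  then have "1 / 32 * real n powr (- 1 / D) \<le> 1 / (8 * real m)"
    by (simp add: powr_minus_divide)
  then show "ennreal (1 / 32 * real n powr (- 1 / real (\<Sum>k = 1..K. d k)))
      \<le> (INF E\<in>estimators K d n. SUP \<mu>\<in>graph_measures K d (collider_graph K).
           \<integral>\<^sup>+ \<omega>. wasserstein K d (E \<omega>) \<mu> \<partial>(\<Pi>\<^sub>M i\<in>{1..n}. \<mu>))"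
    unfolding D_def[symmetric]
    by (intro INF_greatest order_trans[OF ennreal_leI minimax_risk_ge[OF size]])
qed simp

end
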